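(* Let three finite points $\hat{\mathbf x}_1,\hat{\mathbf x}_2,\hat{\mathbf x}_3$ and two lines $\mathbf l_1,\mathbf l_2$ of $\mathrm P\mathbb R^2$ be in general position. If exactly one of the three points lies on one of the two lines (the other two points lying on neither line), and the remaining two points and the intersection point of the two lines are not collinear, then the problem of determining a non-degenerate conic $\mathbf C$ (over $\mathbb C$) such that $\hat{\mathbf x}_i^T\mathbf C\hat{\mathbf x}_i=0$ for $i=1,2,3$ and $\mathbf l_j^T\mathbf C^{-1}\mathbf l_j=0$ for $j=1,2$ has two distinct solutions.
   Context: $\mathrm P\mathbb R^2$ is the real projective plane. A hat denotes a finite point in normalized homogeneous coordinates, i.e. a vector of $\mathbb R^3$ whose third component is $1$. A line is given by a nonzero vector $\mathbf l\in\mathbb R^3$ (up to scale), and $\mathbf x$ lies on $\mathbf l$ iff $\mathbf x^T\mathbf l=0$; the two lines are distinct and the cross product $\mathbf l_1\times\mathbf l_2$ is their intersection point. A side of a triangle is the full line through two of its vertices. Three points and two lines are in general position if the three points are non-collinear, neither $\mathbf l_1$ nor $\mathbf l_2$ is a side of the triangle $\hat{\mathbf x}_1\hat{\mathbf x}_2\hat{\mathbf x}_3$, and the intersection point of $\mathbf l_1$ and $\mathbf l_2$ is not a vertex of that triangle. A conic is a nonzero complex symmetric $3\times3$ matrix up to nonzero scale; it is non-degenerate if its determinant is nonzero. Solutions are counted up to scale. *)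

theory Defs
  imports "HOL-Analysis.Analysis"
begin

text \<open>Points and lines of the real projective plane are represented by nonzero vectors of
  \<^typ>\<open>real^3\<close>, conics by nonzero symmetric matrices of \<^typ>\<open>complex^3^3\<close>.  A triangle is a
  family of three points indexed by the three-element type \<^typ>\<open>3\<close>, a pair of lines a family
  indexed by the two-element type \<^typ>\<open>2\<close> (where \<open>2 = 0\<close>, so its elements are \<open>1\<close> and \<open>2\<close>).\<close>

definition finite_point :: "real^3 \<Rightarrow> bool" where
  "finite_point x \<longleftrightarrow> x $ 3 = 1"

definition proj_eq :: "real^3 \<Rightarrow> real^3 \<Rightarrow> bool" where
  "proj_eq u v \<longleftrightarrow> (\<exists>c. c \<noteq> 0 \<and> v = c *\<^sub>R u)"

definition on_line :: "real^3 \<Rightarrow> real^3 \<Rightarrow> bool" where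
  "on_line x l \<longleftrightarrow> x \<bullet> l = 0"

text \<open>Collinearity in the projective plane.  The library's \<^const>\<open>collinear\<close> is the affine notion
  and would not be scale invariant; points at infinity have to be allowed here.\<close>

definition proj_collinear :: "real^3 \<Rightarrow> real^3 \<Rightarrow> real^3 \<Rightarrow> bool" where
  "proj_collinear x y z \<longleftrightarrow> (\<exists>l. l \<noteq> 0 \<and> on_line x l \<and> on_line y l \<and> on_line z l)"

definition triangle_side :: "(3 \<Rightarrow> real^3) \<Rightarrow> real^3 \<Rightarrow> bool" where
  "triangle_side x l \<longleftrightarrow> (\<exists>i j. i \<noteq> j \<and> proj_eq (cross3 (x i) (x j)) l)"

definition general_position :: "(3 \<Rightarrow> real^3) \<Rightarrow> (2 \<Rightarrow> real^3) \<Rightarrow> bool" where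
  "general_position x l \<longleftrightarrow>
     \<not> proj_collinear (x 1) (x 2) (x 3) \<and>
     (\<forall>j. \<not> triangle_side x (l j)) \<and>
     (\<forall>i. \<not> proj_eq (cross3 (l 1) (l 2)) (x i))"

definition complexify :: "real^'n \<Rightarrow> complex^'n" where
  "complexify v = (\<chi> i. complex_of_real (v $ i))"

text \<open>The bilinear (not sesquilinear) expression \<open>v\<^sup>T A v\<close>.\<close>

definition quad_form :: "complex^'n^'n \<Rightarrow> complex^'n \<Rightarrow> complex" where
  "quad_form A v = (\<Sum>i\<in>UNIV. v $ i * (A *v v) $ i)"

definition conic :: "complex^3^3 \<Rightarrow> bool" where
  "conic C \<longleftrightarrow> C \<noteq> 0 \<and> transpose C = C"

definition nondegenerate :: "complex^3^3 \<Rightarrow> bool" where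
  "nondegenerate C \<longleftrightarrow> det C \<noteq> 0"

definition conic_scale_rel :: "(complex^3^3) rel" where
  "conic_scale_rel = {(C, D). \<exists>c. c \<noteq> 0 \<and> D = (\<chi> i j. c * C $ i $ j)}"

definition conic_solutions :: "(3 \<Rightarrow> real^3) \<Rightarrow> (2 \<Rightarrow> real^3) \<Rightarrow> (complex^3^3) set" where
  "conic_solutions x l =
     {C. conic C \<and> nondegenerate C \<and>
         (\<forall>i. quad_form C (complexify (x i)) = 0) \<and>
         (\<forall>j. quad_form (matrix_inv C) (complexify (l j)) = 0)}"

lemma equiv_conic_scale_rel: "equiv UNIV conic_scale_rel"
proof (rule equivI)
  show "refl conic_scale_rel"
    by (auto simp: refl_on_def conic_scale_rel_def vec_eq_iff intro!: exI[of _ 1])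
  show "sym conic_scale_rel"
  proof (rule symI)
    fix C D assume "(C, D) \<in> conic_scale_rel"
    then obtain c where "c \<noteq> 0" "D = (\<chi> i j. c * C $ i $ j)"
      by (auto simp: conic_scale_rel_def)
    then have "inverse c \<noteq> 0 \<and> C = (\<chi> i j. inverse c * D $ i $ j)"
      by (simp add: vec_eq_iff)
    then show "(D, C) \<in> conic_scale_rel"
      unfolding conic_scale_rel_def by blast
  qed
  show "trans conic_scale_rel"
  proof (rule transI)
    fix C D E assume "(C, D) \<in> conic_scale_rel" "(D, E) \<in> conic_scale_rel"
    then obtain c d where "c \<noteq> 0" "D = (\<chi> i j. c * C $ i $ j)" "d \<noteq> 0" "E = (\<chi> i j. d * D $ i $ j)"
      by (auto simp: conic_scale_rel_def)
    then have "d * c \<noteq> 0 \<and> E = (\<chi> i j. (d * c) * C $ i $ j)"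
      by (simp add: vec_eq_iff)
    then show "(C, E) \<in> conic_scale_rel"
      unfolding conic_scale_rel_def by blast
  qed
qed simp

end

theory Submission
  imports Defs
begin

text \<open>The three points form a basis of \<open>\<real>\<^sup>3\<close>, so let \<open>A\<close> be the matrix with these points as rows, the point
  on a line coming first.  Replacing \<open>C\<close> by \<open>M = A C A\<^sup>T\<close> turns the points into the vertices of the
  coordinate triangle and a line \<open>l\<close> into the vector \<open>A l\<close> of its incidence numbers \<open>x\<^sub>i \<bullet> l\<close>.  The
  conic passes through the vertices iff the symmetric matrix \<open>M\<close> has zero diagonal; its entries off the
  diagonal are then three numbers \<open>a = M\<^sub>1\<^sub>2\<close>, \<open>b = M\<^sub>1\<^sub>3\<close>, \<open>c = M\<^sub>2\<^sub>3\<close> and \<open>det M = 2 a b c\<close>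
  (\<open>conic_solutions_coordinates\<close>).

  Let \<open>u\<close> and \<open>v\<close> be the incidence vectors of the line through the first point and of the other line, so
  that \<open>u\<^sub>1 = 0\<close> and the remaining five entries are nonzero.  A line through a point of the conic touches
  it only as the tangent at that point, so tangency to \<open>u\<close> is a squared linear condition: it says
  \<open>(b u\<^sub>2 - a u\<^sub>3)\<^sup>2 = 0\<close>.  Hence \<open>a = u\<^sub>2\<close> and \<open>b = u\<^sub>3\<close> after rescaling, and tangency to \<open>v\<close> becomes
  a quadratic equation for \<open>c\<close>, namely
  \<open>(v\<^sub>1 c - (u\<^sub>2 v\<^sub>3 + u\<^sub>3 v\<^sub>2))\<^sup>2 = 4 u\<^sub>2 u\<^sub>3 v\<^sub>2 v\<^sub>3\<close>.
  It has two distinct roots since the right-hand side does not vanish.  The product of the roots is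
  \<open>((u\<^sub>2 v\<^sub>3 - u\<^sub>3 v\<^sub>2) / v\<^sub>1)\<^sup>2\<close>, and \<open>u\<^sub>2 v\<^sub>3 - u\<^sub>3 v\<^sub>2\<close> is the triple product of the second point, the
  third point and the intersection of the lines (\<open>triple_product_meet\<close>).  So both conics are
  non-degenerate exactly because these three points are not collinear (\<open>tangency_solutions\<close>).\<close>

section \<open>Congruence of quadratic forms\<close>

lemma matrix_inv_eqI:
  fixes A B :: "'a::field^'n^'n"
  assumes "A ** B = mat 1"
  shows "matrix_inv A = B"
proof -
  have BA: "B ** A = mat 1"
    using assms matrix_left_right_inverse by blast
  have "A ** matrix_inv A = mat 1 \<and> matrix_inv A ** A = mat 1"
    unfolding matrix_inv_def by (rule someI[of _ B]) (simp add: assms BA)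
  then have "matrix_inv A = (B ** A) ** matrix_inv A" "A ** matrix_inv A = mat 1"
    by (simp_all add: BA)
  then show ?thesis
    by (metis matrix_mul_assoc matrix_mul_rid)
qed

lemma matrix_inv_invertible:
  fixes A :: "'a::field^'n^'n"
  assumes "det A \<noteq> 0"
  shows "A ** matrix_inv A = mat 1" "matrix_inv A ** A = mat 1"
proof -
  obtain B where "A ** B = mat 1" "B ** A = mat 1"
    using assms invertible_det_nz[of A] unfolding invertible_def by blast
  then show "A ** matrix_inv A = mat 1" "matrix_inv A ** A = mat 1"
    by (auto simp: matrix_inv_eqI)
qed

text \<open>One identity serves points and lines alike: a conic is evaluated at points by its matrix and at lines
  by the inverse matrix, and both transform by congruence under a change of basis.\<close>
lemma quad_form_congruence:
  "quad_form (transpose A ** N ** A) v = quad_form N (A *v v)"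
proof -
  have "quad_form (transpose A ** N ** A) v
      = (\<Sum>i\<in>UNIV. v $ i * (transpose A *v (N *v (A *v v))) $ i)"
    by (simp add: quad_form_def matrix_vector_mul_assoc matrix_mul_assoc del: transpose_matrix_vector)
  also have "\<dots> = (\<Sum>i\<in>UNIV. \<Sum>m\<in>UNIV. v $ i * A $ m $ i * (N *v (A *v v)) $ m)"
    by (simp add: matrix_vector_mult_def transpose_def vector_matrix_mult_def sum_distrib_left mult_ac)
  also have "\<dots> = (\<Sum>m\<in>UNIV. \<Sum>i\<in>UNIV. v $ i * A $ m $ i * (N *v (A *v v)) $ m)"
    by (rule sum.swap)
  also have "\<dots> = (\<Sum>m\<in>UNIV. (A *v v) $ m * (N *v (A *v v)) $ m)"
    by (rule sum.cong) (auto simp: matrix_vector_mult_def sum_distrib_right mult_ac)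
  finally show ?thesis
    by (simp add: quad_form_def)
qed

lemma matrix_vector_mult_axis: "(M *v axis i 1) $ j = (M $ j $ i :: 'a::comm_semiring_1)"
  by (simp add: matrix_vector_mult_def axis_def if_distrib[of "(*) _"] cong: if_cong)

lemma quad_form_axis: "quad_form M (axis i 1) = M $ i $ i"
  by (simp add: quad_form_def matrix_vector_mult_axis)
    (simp add: axis_def if_distrib[of "\<lambda>z. z * _"] cong: if_cong)

abbreviation scaled :: "complex \<Rightarrow> complex^3^3 \<Rightarrow> complex^3^3" where
  "scaled c M \<equiv> (\<chi> i j. c * M $ i $ j)"

lemma scaled_congruence: "A ** scaled c M ** B = scaled c (A ** M ** B)"
  by (simp add: vec_eq_iff matrix_matrix_mult_def sum_distrib_left sum_distrib_right mult_ac)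

lemma matrix_congruence_iff:
  fixes A C M :: "'a::field^'n^'n"
  assumes "det A \<noteq> 0"
  shows "A ** C ** transpose A = M \<longleftrightarrow> C = matrix_inv A ** M ** transpose (matrix_inv A)"
proof -
  note inv = matrix_inv_invertible[OF assms]
  have "transpose A ** transpose (matrix_inv A) = mat 1" "transpose (matrix_inv A) ** transpose A = mat 1"
    by (simp_all flip: matrix_transpose_mul add: inv transpose_mat)
  with inv show ?thesis
    by (metis matrix_mul_assoc matrix_mul_lid matrix_mul_rid)
qed

lemma quad_form_scaled: "quad_form (scaled c M) v = c * quad_form M v"
  by (simp add: quad_form_def matrix_vector_mult_def sum_distrib_left mult_ac)

section \<open>Conics through the vertices of the coordinate triangle\<close>

text \<open>The symmetric matrices with zero diagonal are the conics through the three coordinate points.\<close>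
definition hollow :: "complex \<Rightarrow> complex \<Rightarrow> complex \<Rightarrow> complex^3^3" where
  "hollow a b c = vector [vector [0, a, b], vector [a, 0, c], vector [b, c, 0]]"

text \<open>Up to sign this is \<open>v\<^sup>T adj(M) v\<close> for \<open>M = hollow a b c\<close>.  Being polynomial in \<open>a\<close>, \<open>b\<close>, \<open>c\<close>, it is
  easier to solve than the equation with the inverse matrix.\<close>
definition tangency :: "complex \<Rightarrow> complex \<Rightarrow> complex \<Rightarrow> complex^3 \<Rightarrow> complex" where
  "tangency a b c v = c\<^sup>2 * (v $ 1)\<^sup>2 + b\<^sup>2 * (v $ 2)\<^sup>2 + a\<^sup>2 * (v $ 3)\<^sup>2
     - 2 * b * c * v $ 1 * v $ 2 - 2 * a * c * v $ 1 * v $ 3 - 2 * a * b * v $ 2 * v $ 3"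

lemma det_hollow: "det (hollow a b c) = 2 * a * b * c"
  by (simp add: hollow_def det_3)

lemma hollow_iff: "(\<exists>a b c. M = hollow a b c) \<longleftrightarrow> transpose M = M \<and> (\<forall>i. M $ i $ i = 0)"
proof
  assume M: "transpose M = M \<and> (\<forall>i. M $ i $ i = 0)"
  have "M $ j $ i = M $ i $ j" for i j
  proof -
    have "transpose M $ i $ j = M $ j $ i"
      by (simp add: transpose_def)
    then show ?thesis
      by (simp only: conjunct1[OF M])
  qed
  from this[of 1 2] this[of 1 3] this[of 2 3]
  have "M = hollow (M $ 1 $ 2) (M $ 1 $ 3) (M $ 2 $ 3)"
    using conjunct2[OF M] by (simp add: hollow_def vec_eq_iff forall_3)
  then show "\<exists>a b c. M = hollow a b c" by blast
next
  assume "\<exists>a b c. M = hollow a b c"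
  then show "transpose M = M \<and> (\<forall>i. M $ i $ i = 0)"
    by (auto simp: hollow_def vec_eq_iff forall_3 transpose_def)
qed

lemma hollow_scaled: "hollow (t * a) (t * b) (t * c) = scaled t (hollow a b c)"
  by (simp add: hollow_def vec_eq_iff forall_3)

lemma tangency_dual_conic:
  assumes "a \<noteq> 0" "b \<noteq> 0" "c \<noteq> 0"
  shows "quad_form (matrix_inv (hollow a b c)) v = 0 \<longleftrightarrow> tangency a b c v = 0"
proof -
  \<comment> \<open>The adjugate of \<open>hollow a b c\<close>.\<close>
  define N :: "complex^3^3" where
    "N = vector [vector [- c\<^sup>2, b * c, a * c], vector [b * c, - b\<^sup>2, a * b], vector [a * c, a * b, - a\<^sup>2]]"
  define d where "d = 1 / (2 * a * b * c)"
  have "hollow a b c ** scaled d N = mat 1"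
    using assms
    by (simp add: vec_eq_iff forall_3 matrix_matrix_mult_def sum_3 hollow_def N_def mat_def d_def
        field_simps power2_eq_square)
  then have "matrix_inv (hollow a b c) = scaled d N"
    by (rule matrix_inv_eqI)
  then have "quad_form (matrix_inv (hollow a b c)) v = d * quad_form N v"
    by (simp only: quad_form_scaled)
  also have "quad_form N v = - tangency a b c v"
    by (simp add: quad_form_def matrix_vector_mult_def sum_3 N_def tangency_def algebra_simps power2_eq_square)
  finally show ?thesis
    using assms by (simp add: d_def)
qed

section \<open>Solving the tangency equations\<close>

text \<open>The condition \<open>u\<^sub>1 = 0\<close> puts the line through the first coordinate point, which lies on the conic.
  Only the tangent there can touch the conic, and it is counted twice, whence the square.\<close>
lemma tangency_touching_vertex:
  assumes "u $ 1 = 0"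
  shows "tangency a b c u = (b * u $ 2 - a * u $ 3)\<^sup>2"
  using assms by (simp add: tangency_def power2_eq_square algebra_simps)

text \<open>The first equation fixes the ratio \<open>a : b = u\<^sub>2 : u\<^sub>3\<close>, and \<open>t\<close> is the remaining scale.  The second
  is quadratic in \<open>c / t\<close>: its discriminant is a nonzero multiple of \<open>u\<^sub>2 u\<^sub>3 v\<^sub>2 v\<^sub>3\<close>, which makes
  the roots \<open>p\<close>, \<open>q\<close> distinct, and its constant term is \<open>(u\<^sub>2 v\<^sub>3 - u\<^sub>3 v\<^sub>2)\<^sup>2\<close>, which keeps them away from \<open>0\<close>.\<close>
lemma tangency_solutions:
  fixes u v :: "complex^3"
  assumes u: "u $ 1 = 0" "u $ 2 \<noteq> 0" "u $ 3 \<noteq> 0"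
    and v: "v $ 1 \<noteq> 0" "v $ 2 \<noteq> 0" "v $ 3 \<noteq> 0"
    and uv: "u $ 2 * v $ 3 \<noteq> u $ 3 * v $ 2"
  obtains p q where "p \<noteq> q"
    "\<And>a b c. a \<noteq> 0 \<and> b \<noteq> 0 \<and> c \<noteq> 0 \<and> tangency a b c u = 0 \<and> tangency a b c v = 0 \<longleftrightarrow>
       (\<exists>t. t \<noteq> 0 \<and> a = t * u $ 2 \<and> b = t * u $ 3 \<and> (c = t * p \<or> c = t * q))"
proof -
  define m where "m = u $ 2 * v $ 3 + u $ 3 * v $ 2"
  define s where "s = csqrt (u $ 2 * u $ 3 * v $ 2 * v $ 3)"
  have s2: "s\<^sup>2 = u $ 2 * u $ 3 * v $ 2 * v $ 3"
    by (simp add: s_def)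
  then have s0: "s \<noteq> 0"
    using u v by auto
  define p where "p = (m + 2 * s) / v $ 1"
  define q where "q = (m - 2 * s) / v $ 1"
  have quadratic: "tangency (u $ 2) (u $ 3) c v = (v $ 1)\<^sup>2 * ((c - p) * (c - q))" for c
  proof -
    have "(v $ 1)\<^sup>2 * ((c - p) * (c - q)) = (v $ 1 * c - m)\<^sup>2 - 4 * s\<^sup>2"
      using v by (simp add: p_def q_def field_simps power2_eq_square)
    also have "\<dots> = tangency (u $ 2) (u $ 3) c v"
      unfolding s2 by (simp add: m_def tangency_def power2_eq_square algebra_simps)
    finally show ?thesis ..
  qed
  \<comment> \<open>Compare the constant terms of the quadratic.\<close>
  have "(v $ 1)\<^sup>2 * (p * q) = (u $ 2 * v $ 3 - u $ 3 * v $ 2)\<^sup>2"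
    using quadratic[of 0] by (simp add: tangency_def power2_eq_square algebra_simps)
  then have pq0: "p \<noteq> 0" "q \<noteq> 0"
    using uv by auto
  show thesis
  proof (rule that[of p q])
    show "p \<noteq> q"
      using s0 v by (simp add: p_def q_def)
    have homogeneous: "tangency (t * u $ 2) (t * u $ 3) (t * d) v = t\<^sup>2 * tangency (u $ 2) (u $ 3) d v" for t d
      by (simp add: tangency_def power2_eq_square algebra_simps)
    fix a b c
    show "a \<noteq> 0 \<and> b \<noteq> 0 \<and> c \<noteq> 0 \<and> tangency a b c u = 0 \<and> tangency a b c v = 0 \<longleftrightarrow>
       (\<exists>t. t \<noteq> 0 \<and> a = t * u $ 2 \<and> b = t * u $ 3 \<and> (c = t * p \<or> c = t * q))" (is "?L \<longleftrightarrow> ?R")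
    proof
      assume L: ?L
      define t where "t = a / u $ 2"
      have "t \<noteq> 0" "a = t * u $ 2" "c = t * (c / t)"
        using L u by (auto simp: t_def)
      moreover have "b = t * u $ 3"
        using L u by (simp add: tangency_touching_vertex t_def field_simps)
      moreover have "c / t = p \<or> c / t = q"
        using L homogeneous[of t "c / t"] calculation v by (auto simp: quadratic)
      ultimately show ?R by metis
    next
      assume ?R
      then obtain t d where "t \<noteq> 0" "a = t * u $ 2" "b = t * u $ 3" "c = t * d" "d = p \<or> d = q"
        by blast
      then show ?L
        using u pq0 by (auto simp: tangency_touching_vertex homogeneous quadratic)
    qed
  qed
qed

section \<open>Barycentric coordinates\<close>

definition vertex_matrix :: "(3 \<Rightarrow> real^3) \<Rightarrow> complex^3^3" where
  "vertex_matrix x = (\<chi> i. complexify (x i))"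

lemma vertex_matrix_line:
  "(vertex_matrix x *v complexify l) $ i = of_real (x i \<bullet> l)"
  by (simp add: vertex_matrix_def complexify_def matrix_vector_mult_def inner_vec_def)

text \<open>A common line of the three points is a nonzero vector in the kernel of the matrix with rows \<open>x\<close>, \<open>y\<close>,
  \<open>z\<close>, whose determinant is the triple product.\<close>
lemma proj_collinear_iff_triple_product: "proj_collinear x y z \<longleftrightarrow> x \<bullet> cross3 y z = 0"
proof -
  define R :: "real^3^3" where "R = vector [x, y, z]"
  have kernel: "R *v l = 0 \<longleftrightarrow> on_line x l \<and> on_line y l \<and> on_line z l" for l
    by (simp add: R_def on_line_def vec_eq_iff forall_3 matrix_vector_mult_def inner_vec_def)
  have "x \<bullet> cross3 y z = 0 \<longleftrightarrow> \<not> invertible R"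
    by (simp add: R_def dot_cross_det invertible_det_nz)
  also have "\<dots> \<longleftrightarrow> (\<exists>l. R *v l = 0 \<and> l \<noteq> 0)"
    unfolding invertible_left_inverse by (auto simp: matrix_left_invertible_ker)
  finally show ?thesis
    by (auto simp: kernel proj_collinear_def)
qed

lemma det_vertex_matrix:
  "det (vertex_matrix x) = of_real (x 1 \<bullet> cross3 (x 2) (x 3))"
  by (simp add: vertex_matrix_def complexify_def det_3 cross3_def inner_vec_def sum_3 algebra_simps)

text \<open>With \<open>M = A C A\<^sup>T\<close>, the diagonal entries of \<open>M\<close> are the values of \<open>C\<close> at the given points, and the
  inverse of \<open>C\<close> is \<open>A\<^sup>T N A\<close> where \<open>N\<close> is the inverse of \<open>M\<close>; so the dual conic evaluated at \<open>l\<close> is \<open>N\<close>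
  evaluated at \<open>A l\<close>.\<close>
lemma conic_solutions_coordinates:
  fixes x :: "3 \<Rightarrow> real^3" and l :: "2 \<Rightarrow> real^3"
  defines "A \<equiv> vertex_matrix x"
  assumes det: "det A \<noteq> 0"
  shows "C \<in> conic_solutions x l \<longleftrightarrow>
    (\<exists>a b c. A ** C ** transpose A = hollow a b c \<and> a \<noteq> 0 \<and> b \<noteq> 0 \<and> c \<noteq> 0 \<and>
       (\<forall>j. tangency a b c (A *v complexify (l j)) = 0))"
proof -
  define M where "M = A ** C ** transpose A"
  define B where "B = matrix_inv A"
  have AB: "A ** B = mat 1" "B ** A = mat 1"
    using det by (simp_all add: B_def matrix_inv_invertible)
  have ABt: "transpose B ** transpose A = mat 1"
    by (simp flip: matrix_transpose_mul add: AB transpose_mat)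
  have C: "C = B ** M ** transpose B"
    using matrix_congruence_iff[OF det] unfolding M_def B_def by blast
  have symmetric: "transpose C = C \<longleftrightarrow> transpose M = M"
    by (metis C M_def matrix_mul_assoc matrix_transpose_mul transpose_transpose)
  have diagonal: "quad_form C (complexify (x i)) = M $ i $ i" for i
  proof -
    have "M $ i $ i = quad_form (transpose (transpose A) ** C ** transpose A) (axis i 1)"
      by (simp add: M_def quad_form_axis)
    also have "\<dots> = quad_form C (transpose A *v axis i 1)"
      by (rule quad_form_congruence)
    also have "transpose A *v axis i 1 = complexify (x i)"
      by (simp add: A_def vertex_matrix_def vec_eq_iff matrix_vector_mult_axis transpose_def
          del: transpose_matrix_vector)
    finally show ?thesis by simp
  qed
  have dets: "det C \<noteq> 0 \<longleftrightarrow> det M \<noteq> 0"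
    using det by (simp add: M_def det_mul)
  have dual: "quad_form (matrix_inv C) (complexify (l j)) = quad_form (matrix_inv M) (A *v complexify (l j))"
    if "det M \<noteq> 0" for j
  proof -
    have "C ** (transpose A ** matrix_inv M ** A) = B ** (M ** ((transpose B ** transpose A) ** matrix_inv M)) ** A"
      by (simp add: C matrix_mul_assoc)
    also have "\<dots> = mat 1"
      using that by (simp add: AB ABt matrix_inv_invertible)
    finally have "matrix_inv C = transpose A ** matrix_inv M ** A"
      by (rule matrix_inv_eqI)
    then show ?thesis
      by (simp only: quad_form_congruence)
  qed
  have "C \<noteq> 0" if "det C \<noteq> 0"
    using that by (auto simp: det_3)
  then have "C \<in> conic_solutions x l \<longleftrightarrow> (\<exists>a b c. M = hollow a b c) \<and> det M \<noteq> 0 \<and>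
      (\<forall>j. quad_form (matrix_inv M) (A *v complexify (l j)) = 0)"
    unfolding conic_solutions_def conic_def nondegenerate_def hollow_iff mem_Collect_eq
    using symmetric diagonal dets dual by auto
  also have "\<dots> \<longleftrightarrow> (\<exists>a b c. M = hollow a b c \<and> a \<noteq> 0 \<and> b \<noteq> 0 \<and> c \<noteq> 0 \<and>
       (\<forall>j. tangency a b c (A *v complexify (l j)) = 0))"
    using tangency_dual_conic by (auto simp: det_hollow) metis
  finally show ?thesis
    by (simp add: M_def)
qed

section \<open>Counting solutions up to scale\<close>

lemma card_quotient_two_representatives:
  assumes "equiv UNIV r" "a \<in> S" "b \<in> S" "(a, b) \<notin> r"
    and "\<And>y. y \<in> S \<Longrightarrow> (a, y) \<in> r \<or> (b, y) \<in> r"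
  shows "card (S // r) = 2"
proof -
  have "S // r = {r `` {a}, r `` {b}}"
    using assms(2,3,5) equiv_class_eq[OF assms(1)] unfolding quotient_def by blast
  moreover have "r `` {a} \<noteq> r `` {b}"
    using assms(1,4) by (simp add: eq_equiv_class_iff)
  ultimately show ?thesis by simp
qed

text \<open>The statement for a fixed labelling: point \<open>1\<close> lies on line \<open>1\<close>, and the position of the other points
  and lines is expressed by incidence numbers.  The solutions are the multiples of the two matrices \<open>T p\<close>
  and \<open>T q\<close> obtained from the roots \<open>p\<close>, \<open>q\<close> of the quadratic by undoing the change of basis.\<close>
lemma two_conics_coordinates:
  fixes x :: "3 \<Rightarrow> real^3" and l :: "2 \<Rightarrow> real^3"
  assumes "\<not> proj_collinear (x 1) (x 2) (x 3)"
    and u: "x 1 \<bullet> l 1 = 0" "x 2 \<bullet> l 1 \<noteq> 0" "x 3 \<bullet> l 1 \<noteq> 0"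
    and v: "x 1 \<bullet> l 2 \<noteq> 0" "x 2 \<bullet> l 2 \<noteq> 0" "x 3 \<bullet> l 2 \<noteq> 0"
    and uv: "(x 2 \<bullet> l 1) * (x 3 \<bullet> l 2) \<noteq> (x 3 \<bullet> l 1) * (x 2 \<bullet> l 2)"
  shows "card (conic_solutions x l // conic_scale_rel) = 2"
proof -
  define A where "A = vertex_matrix x"
  define B where "B = matrix_inv A"
  have det: "det A \<noteq> 0"
    using assms(1) by (simp add: A_def det_vertex_matrix proj_collinear_iff_triple_product)
  have AC: "A ** C ** transpose A = M \<longleftrightarrow> C = B ** M ** transpose B" for C M
    unfolding B_def using det by (rule matrix_congruence_iff)
  define f g where "f = complex_of_real (x 2 \<bullet> l 1)" and "g = complex_of_real (x 3 \<bullet> l 1)"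
  have coords: "(A *v complexify (l j)) $ i = of_real (x i \<bullet> l j)" for i j
    by (simp add: A_def vertex_matrix_line)
  have "of_real (x 2 \<bullet> l 1) * of_real (x 3 \<bullet> l 2) \<noteq> (of_real (x 3 \<bullet> l 1) * of_real (x 2 \<bullet> l 2) :: complex)"
    using uv by (metis of_real_eq_iff of_real_mult)
  then obtain p q where pq: "p \<noteq> q"
    and sols: "\<And>a b c. a \<noteq> 0 \<and> b \<noteq> 0 \<and> c \<noteq> 0 \<and> tangency a b c (A *v complexify (l 1)) = 0 \<and>
         tangency a b c (A *v complexify (l 2)) = 0 \<longleftrightarrow>
       (\<exists>t. t \<noteq> 0 \<and> a = t * f \<and> b = t * g \<and> (c = t * p \<or> c = t * q))"
    using tangency_solutions[of "A *v complexify (l 1)" "A *v complexify (l 2)"] u v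
    unfolding coords f_def g_def by auto
  define T where "T c = B ** hollow f g c ** transpose B" for c
  have mem: "C \<in> conic_solutions x l \<longleftrightarrow> (\<exists>t. t \<noteq> 0 \<and> (C = scaled t (T p) \<or> C = scaled t (T q)))" for C
  proof -
    have "C \<in> conic_solutions x l \<longleftrightarrow> (\<exists>a b c t. C = B ** hollow a b c ** transpose B \<and>
        t \<noteq> 0 \<and> a = t * f \<and> b = t * g \<and> (c = t * p \<or> c = t * q))"
      using conic_solutions_coordinates[of x C l] det
      by (simp add: A_def[symmetric] forall_2 sols AC)
    also have "\<dots> \<longleftrightarrow> (\<exists>t. t \<noteq> 0 \<and> (C = B ** hollow (t * f) (t * g) (t * p) ** transpose B \<or>
        C = B ** hollow (t * f) (t * g) (t * q) ** transpose B))"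
      by blast
    finally show ?thesis
      by (simp only: hollow_scaled scaled_congruence T_def)
  qed
  show ?thesis
  proof (rule card_quotient_two_representatives[OF equiv_conic_scale_rel])
    have "T p = scaled 1 (T p)" "T q = scaled 1 (T q)"
      by (simp_all add: vec_eq_iff)
    then show "T p \<in> conic_solutions x l" "T q \<in> conic_solutions x l"
      unfolding mem by (metis zero_neq_one)+
    show "(T p, T q) \<notin> conic_scale_rel"
    proof
      assume "(T p, T q) \<in> conic_scale_rel"
      then obtain t where "T q = scaled t (T p)"
        by (auto simp: conic_scale_rel_def)
      then have "T q = B ** hollow (t * f) (t * g) (t * p) ** transpose B"
        by (simp only: hollow_scaled scaled_congruence T_def)
      then have "hollow f g q = hollow (t * f) (t * g) (t * p)"
        unfolding T_def by (metis AC)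
      \<comment> \<open>The entry \<open>f \<noteq> 0\<close> forces the scale factor to be \<open>1\<close>.\<close>
      then have "f = t * f" "q = t * p"
        by (simp_all add: hollow_def vec_eq_iff forall_3)
      then show False
        using pq u by (auto simp: f_def)
    qed
  next
    fix C assume "C \<in> conic_solutions x l"
    then show "(T p, C) \<in> conic_scale_rel \<or> (T q, C) \<in> conic_scale_rel"
      by (auto simp: mem conic_scale_rel_def)
  qed
qed

lemma conic_solutions_reindex:
  assumes "surj \<sigma>" "surj \<tau>"
  shows "conic_solutions (x \<circ> \<sigma>) (l \<circ> \<tau>) = conic_solutions x l"
proof -
  have "(\<forall>i. quad_form C (complexify (x (\<sigma> i))) = 0) \<longleftrightarrow> (\<forall>i. quad_form C (complexify (x i)) = 0)" for C
    using assms(1) by (metis surjD)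
  moreover have "(\<forall>j. quad_form C (complexify (l (\<tau> j))) = 0) \<longleftrightarrow> (\<forall>j. quad_form C (complexify (l j)) = 0)" for C
    using assms(2) by (metis surjD)
  ultimately show ?thesis
    by (simp add: conic_solutions_def)
qed

section \<open>General position in terms of incidence numbers\<close>

text \<open>The square of this minor of incidence numbers is the constant term of the quadratic for \<open>c\<close>.  So
  one of the roots vanishes exactly when \<open>x\<close>, \<open>y\<close> and the intersection of the lines are collinear.\<close>
lemma triple_product_meet:
  "x \<bullet> cross3 y (cross3 l m) = (x \<bullet> l) * (y \<bullet> m) - (y \<bullet> l) * (x \<bullet> m)"
  by (simp add: Lagrange inner_diff_right mult_ac)

text \<open>A vector orthogonal to \<open>l\<close> and \<open>m\<close> has zero cross product with \<open>l \<times> m\<close> by Lagrange's identity, so it is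
  parallel to it.\<close>
lemma point_on_both_lines:
  assumes "x \<bullet> l = 0" "x \<bullet> m = 0" "x \<noteq> 0" "cross3 l m \<noteq> 0"
  shows "proj_eq (cross3 l m) x"
proof -
  define w where "w = cross3 l m"
  have "cross3 x w = 0"
    using assms by (simp add: w_def Lagrange)
  then have eq: "(w \<bullet> w) *\<^sub>R x = (w \<bullet> x) *\<^sub>R w"
    using Lagrange[of w x w] by simp
  have ww: "w \<bullet> w \<noteq> 0"
    using assms by (simp add: w_def)
  have "x = inverse (w \<bullet> w) *\<^sub>R ((w \<bullet> w) *\<^sub>R x)"
    using ww by simp
  also have "\<dots> = (inverse (w \<bullet> w) * (w \<bullet> x)) *\<^sub>R w"
    unfolding eq by simp
  finally have x: "x = (inverse (w \<bullet> w) * (w \<bullet> x)) *\<^sub>R w" .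
  then have "inverse (w \<bullet> w) * (w \<bullet> x) \<noteq> 0"
    using assms(3) by (metis scaleR_zero_left)
  then show ?thesis
    using x unfolding proj_eq_def w_def by blast
qed

text \<open>Relabelling by a cyclic shift: the index types carry addition modulo \<open>3\<close> and \<open>2\<close>.\<close>
lemma obtain_labelling_3:
  fixes k :: 3
  obtains \<sigma> :: "3 \<Rightarrow> 3" where "surj \<sigma>" "\<sigma> 1 = k" "\<sigma> 2 \<noteq> k" "\<sigma> 3 \<noteq> k" "\<sigma> 2 \<noteq> \<sigma> 3"
proof
  have "inj (\<lambda>i. i + (k - 1))" by (simp add: inj_def)
  then show "surj (\<lambda>i. i + (k - 1))" by (simp add: finite_UNIV_inj_surj)
qed (auto simp: algebra_simps)

lemma obtain_labelling_2:
  fixes j :: 2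
  obtains \<tau> :: "2 \<Rightarrow> 2" where "surj \<tau>" "\<tau> 1 = j" "\<tau> 2 \<noteq> j"
proof
  have "inj (\<lambda>i. i + (j - 1))" by (simp add: inj_def)
  then show "surj (\<lambda>i. i + (j - 1))" by (simp add: finite_UNIV_inj_surj)
qed (auto simp: algebra_simps)

theorem theorem7:
  fixes x :: "3 \<Rightarrow> real^3" and l :: "2 \<Rightarrow> real^3" and k :: 3
  assumes finite_points: "\<And>i. finite_point (x i)"
    and lines: "\<And>j. l j \<noteq> 0"
    and distinct_lines: "\<not> proj_eq (l 1) (l 2)"
    and general_position: "general_position x l"
    and one_on_line: "\<exists>j. on_line (x k) (l j)"
    and others_on_no_line: "\<And>i j. i \<noteq> k \<Longrightarrow> \<not> on_line (x i) (l j)"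
    and remaining_not_collinear:
      "\<And>i i'. i \<noteq> k \<Longrightarrow> i' \<noteq> k \<Longrightarrow> i \<noteq> i' \<Longrightarrow>
         \<not> proj_collinear (x i) (x i') (cross3 (l 1) (l 2))"
  shows "card (conic_solutions x l // conic_scale_rel) = 2"
proof -
  obtain \<sigma> :: "3 \<Rightarrow> 3" where \<sigma>: "surj \<sigma>" "\<sigma> 1 = k" "\<sigma> 2 \<noteq> k" "\<sigma> 3 \<noteq> k" "\<sigma> 2 \<noteq> \<sigma> 3"
    by (rule obtain_labelling_3)
  obtain j where j: "x k \<bullet> l j = 0"
    using one_on_line by (auto simp: on_line_def)
  obtain \<tau> :: "2 \<Rightarrow> 2" where \<tau>: "surj \<tau>" "\<tau> 1 = j" "\<tau> 2 \<noteq> j"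
    by (rule obtain_labelling_2)
  have meet: "x (\<sigma> 2) \<bullet> cross3 (x (\<sigma> 3)) (cross3 (l 1) (l 2)) \<noteq> 0"
    using remaining_not_collinear \<sigma> by (simp add: proj_collinear_iff_triple_product)
  have not_both: "\<not> (x k \<bullet> l 1 = 0 \<and> x k \<bullet> l 2 = 0)"
  proof
    assume "x k \<bullet> l 1 = 0 \<and> x k \<bullet> l 2 = 0"
    moreover have "x k \<noteq> 0"
      using finite_points[of k] by (auto simp: finite_point_def)
    moreover have "cross3 (l 1) (l 2) \<noteq> 0"
      using meet by auto
    ultimately have "proj_eq (cross3 (l 1) (l 2)) (x k)"
      by (intro point_on_both_lines) auto
    then show False
      using general_position by (auto simp: general_position_def)
  qed
  have "card (conic_solutions (x \<circ> \<sigma>) (l \<circ> \<tau>) // conic_scale_rel) = 2"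
  proof (rule two_conics_coordinates)
    have "\<not> proj_collinear (x 1) (x 2) (x 3)"
      using general_position by (simp add: general_position_def)
    moreover have "(\<forall>i. P (\<sigma> i)) \<longleftrightarrow> (\<forall>i. P i)" for P
      using \<sigma>(1) by (metis surjD)
    from this[of "\<lambda>i. on_line (x i) m" for m]
    have "proj_collinear (x (\<sigma> 1)) (x (\<sigma> 2)) (x (\<sigma> 3)) \<longleftrightarrow> proj_collinear (x 1) (x 2) (x 3)"
      by (simp add: proj_collinear_def forall_3)
    ultimately show "\<not> proj_collinear ((x \<circ> \<sigma>) 1) ((x \<circ> \<sigma>) 2) ((x \<circ> \<sigma>) 3)"
      by simp
    show "(x \<circ> \<sigma>) 1 \<bullet> (l \<circ> \<tau>) 1 = 0"
      using j by (simp add: \<sigma>(2) \<tau>(2))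
    show "(x \<circ> \<sigma>) 1 \<bullet> (l \<circ> \<tau>) 2 \<noteq> 0"
      using not_both j \<tau>(3) exhaust_2[of j] exhaust_2[of "\<tau> 2"] by (auto simp: \<sigma>(2))
    show "(x \<circ> \<sigma>) 2 \<bullet> (l \<circ> \<tau>) 1 \<noteq> 0" "(x \<circ> \<sigma>) 3 \<bullet> (l \<circ> \<tau>) 1 \<noteq> 0"
         "(x \<circ> \<sigma>) 2 \<bullet> (l \<circ> \<tau>) 2 \<noteq> 0" "(x \<circ> \<sigma>) 3 \<bullet> (l \<circ> \<tau>) 2 \<noteq> 0"
      using others_on_no_line \<sigma> by (auto simp: on_line_def)
    show "((x \<circ> \<sigma>) 2 \<bullet> (l \<circ> \<tau>) 1) * ((x \<circ> \<sigma>) 3 \<bullet> (l \<circ> \<tau>) 2) \<noteq>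
          ((x \<circ> \<sigma>) 3 \<bullet> (l \<circ> \<tau>) 1) * ((x \<circ> \<sigma>) 2 \<bullet> (l \<circ> \<tau>) 2)"
      using meet \<tau>(2,3) exhaust_2[of j] exhaust_2[of "\<tau> 2"]
      unfolding triple_product_meet by (auto simp: mult.commute)
  qed
  then show ?thesis
    by (simp add: conic_solutions_reindex[OF \<sigma>(1) \<tau>(1)])
qed

end
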